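(* Let $S_1\subseteq S_2$ be two subrings of a finite ring $R$ and let $r\in K(S_1,R)$. Then $$\mathrm{Pr}_r(S_1,R)\leq |S_2:S_1|\,\mathrm{Pr}_r(S_2,R).$$
   Context: For elements $x,y$ of a ring $R$, $[x,y]=xy-yx$. For a subring $S$ of a finite ring $R$ and $r\in R$, $$\mathrm{Pr}_r(S,R)=\frac{|\{(x,y)\in S\times R : [x,y]=r\}|}{|S||R|}.$$ $K(S,R)=\{[x,y] : x\in S,\ y\in R\}$. $|S_2:S_1|$ denotes the index of the additive group of $S_1$ in the additive group of $S_2$. *)

theory Defs
  imports Complex_Main
begin

text \<open>
  Rings are associative but need be neither commutative nor unital, so the ambient ring is a type
  of class \<open>ring\<close>, and a subring need not contain a unit even if the ambient ring has one.
\<close>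

definition commutator :: "'a::ring \<Rightarrow> 'a \<Rightarrow> 'a" where
  "commutator x y = x * y - y * x"

definition is_subring :: "'a::ring set \<Rightarrow> bool" where
  "is_subring S \<longleftrightarrow>
     0 \<in> S \<and> (\<forall>x\<in>S. - x \<in> S) \<and> (\<forall>x\<in>S. \<forall>y\<in>S. x + y \<in> S \<and> x * y \<in> S)"

definition Pr :: "'a::ring \<Rightarrow> 'a set \<Rightarrow> 'a set \<Rightarrow> real" where
  "Pr r S R = real (card {(x, y). (x, y) \<in> S \<times> R \<and> commutator x y = r})
     / (real (card S) * real (card R))"

definition K :: "'a::ring set \<Rightarrow> 'a set \<Rightarrow> 'a set" where
  "K S R = {commutator x y | x y. x \<in> S \<and> y \<in> R}"

text \<open>The index of \<open>T\<close> in \<open>S\<close>: the number of additive cosets \<open>a + T\<close> with \<open>a \<in> S\<close>.\<close>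

definition add_index :: "'a::ring set \<Rightarrow> 'a set \<Rightarrow> nat" where
  "add_index S T = card {(\<lambda>t. a + t) ` T | a. a \<in> S}"

end

theory Submission
  imports Defs
begin

text \<open>
  Every pair in \<open>S1 \<times> R\<close> with commutator \<open>r\<close> also lies in \<open>S2 \<times> R\<close>, so passing from \<open>S1\<close> to \<open>S2\<close> can
  only increase the numerator of \<open>Pr\<close>.  The denominator grows by the factor \<open>card S2 / card S1\<close>, and
  this factor is at most the index because \<open>S2\<close> is covered by its cosets of \<open>S1\<close>, all of which
  have as many elements as \<open>S1\<close>.
\<close>

text \<open>
  Each \<open>a \<in> S\<close> lies in its own translate \<open>a + T\<close>, because \<open>0 \<in> T\<close>.  So the translates cover \<open>S\<close>, and
  counting them one by one bounds its size.
\<close>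

lemma card_le_add_index_mult_card:
  fixes S T :: "'a::ring set"
  assumes "finite S" and "finite T" and "0 \<in> T"
  shows "card S \<le> add_index S T * card T"
proof -
  define \<C> where "\<C> = {(\<lambda>t. a + t) ` T | a. a \<in> S}"
  have \<C>_eq: "\<C> = (\<lambda>a. (\<lambda>t. a + t) ` T) ` S"
    by (auto simp: \<C>_def)
  have "finite \<C>"
    using assms by (simp add: \<C>_eq)
  have "a \<in> (\<lambda>t. a + t) ` T" for a
    using assms by (intro image_eqI[of _ _ 0]) auto
  then have "S \<subseteq> \<Union>\<C>"
    by (auto simp: \<C>_eq)
  moreover have "finite (\<Union>\<C>)"
    using \<open>finite \<C>\<close> \<open>finite T\<close> by (auto simp: \<C>_eq)
  ultimately have "card S \<le> card (\<Union>\<C>)"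
    by (rule card_mono[rotated])
  also have "\<dots> \<le> (\<Sum>C\<in>\<C>. card C)"
    by (rule card_Union_le_sum_card)
  also have "\<dots> = (\<Sum>C\<in>\<C>. card T)"
    by (intro sum.cong) (auto simp: \<C>_eq card_image)
  also have "\<dots> = add_index S T * card T"
    by (simp add: add_index_def \<C>_def)
  finally show ?thesis .
qed

theorem proposition3p3:
  fixes S1 S2 :: "'a::{ring, finite} set" and r :: 'a
  assumes "is_subring S1" and "is_subring S2" and "S1 \<subseteq> S2"
    and "r \<in> K S1 (UNIV :: 'a set)"
  shows "Pr r S1 (UNIV :: 'a set) \<le> real (add_index S2 S1) * Pr r S2 (UNIV :: 'a set)"
proof -
  define N where "N S = card {(x, y). (x, y) \<in> S \<times> (UNIV :: 'a set) \<and> commutator x y = r}"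
    for S :: "'a set"
  define n where "n = real (card (UNIV :: 'a set))"
  have Pr_eq: "Pr r S UNIV = real (N S) / (real (card S) * n)" for S
    by (simp add: Pr_def N_def n_def)
  have "0 \<in> S1" "0 \<in> S2"
    using assms by (auto simp: is_subring_def)
  then have "card S1 > 0" "card S2 > 0" "n > 0"
    by (auto simp: card_gt_0_iff n_def)
  have "N S1 \<le> N S2"
    unfolding N_def using \<open>S1 \<subseteq> S2\<close> by (intro card_mono) auto
  moreover have "card S2 \<le> add_index S2 S1 * card S1"
    using \<open>0 \<in> S1\<close> by (intro card_le_add_index_mult_card) auto
  ultimately have "N S1 * card S2 \<le> N S2 * (add_index S2 S1 * card S1)"
    by (rule mult_le_mono)
  then have "real (N S1) * real (card S2) \<le> real (N S2) * (real (add_index S2 S1) * real (card S1))"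
    by (simp only: of_nat_mult[symmetric] of_nat_le_iff)
  then show ?thesis
    using \<open>card S1 > 0\<close> \<open>card S2 > 0\<close> \<open>n > 0\<close>
    by (simp add: Pr_eq divide_simps mult_ac)
qed

end
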